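(* Let $C$ be a category with pullbacks and a stable system $M$. Let $S$ be the class of sections (split monomorphisms) of $C$. Let $f\colon x\to x$ be a morphism where $x$ is $M$-Noetherian and $f^n$ is stably an $S$-extremal epimorphism for each $n\in\mathbb{N}$ (with $f^0=\mathrm{id}_x$ and $f^{n+1}=f\circ f^n$). Assume that $f$ has a fixed point $\pi_0\colon I_0\to x$ in $M$, i.e. $\pi_0\in M$ and $f\pi_0=\pi_0$. Then the pullback of $f$ along $\pi_0$ is an isomorphism.
   Context: A class of morphisms is a system if it contains all isomorphisms and is closed under composition; it is stable if it is closed under pullback along arbitrary morphisms. A morphism $g$ is an $S$-extremal epimorphism if $g=mh$ with $m\in S$ implies that $m$ is an isomorphism; it is stably so if every pullback of $g$ is an $S$-extremal epimorphism. An object $x$ is $M$-Noetherian if for every (covariant) functor $F\colon\mathbb{N}\to C/x$ from the poset $\mathbb N$ such that each structure morphism $F(n)\colon x_n\to x$ is in $M$, there is $i_0\in\mathbb N$ such that $F(i\to j)\colon x_i\to x_j$ is an isomorphism for all $i_0\le i\le j$. The pullback of $f$ along $\pi_0$ is the projection $I_0\times_x x\to I_0$ from the pullback of $f$ and $\pi_0$. *)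

theory Defs
  imports Main
begin

text \<open>
  A category with objects of type \<open>'o\<close> and morphisms of type \<open>'m\<close>, both cut out by carrier sets.
  \<open>g \<cdot> f\<close> is the composite ``\<open>f\<close> first, then \<open>g\<close>''; its value on non-composable pairs, like the
  values of all operations off the carriers, is unconstrained.
\<close>

record ('o, 'm) cat =
  Obj :: "'o set"
  Arr :: "'m set"
  Dom :: "'m \<Rightarrow> 'o"
  Cod :: "'m \<Rightarrow> 'o"
  Ident :: "'o \<Rightarrow> 'm"
  Comp :: "'m \<Rightarrow> 'm \<Rightarrow> 'm"  (infixl "\<cdot>\<index>" 70)

definition Hom :: "('o, 'm) cat \<Rightarrow> 'o \<Rightarrow> 'o \<Rightarrow> 'm set" where
  "Hom C a b = {f \<in> Arr C. Dom C f = a \<and> Cod C f = b}"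

locale category =
  fixes C :: "('o, 'm) cat" (structure)
  assumes Dom_Obj: "f \<in> Arr C \<Longrightarrow> Dom C f \<in> Obj C"
    and Cod_Obj: "f \<in> Arr C \<Longrightarrow> Cod C f \<in> Obj C"
    and Ident_Hom: "a \<in> Obj C \<Longrightarrow> Ident C a \<in> Hom C a a"
    and Comp_Hom: "f \<in> Hom C a b \<Longrightarrow> g \<in> Hom C b c \<Longrightarrow> g \<cdot> f \<in> Hom C a c"
    and Comp_Ident: "f \<in> Hom C a b \<Longrightarrow> f \<cdot> Ident C a = f"
    and Ident_Comp: "f \<in> Hom C a b \<Longrightarrow> Ident C b \<cdot> f = f"
    and Comp_assoc: "f \<in> Hom C a b \<Longrightarrow> g \<in> Hom C b c \<Longrightarrow> h \<in> Hom C c d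
      \<Longrightarrow> (h \<cdot> g) \<cdot> f = h \<cdot> (g \<cdot> f)"

locale cat_functor = A: category A + B: category B
  for A :: "('o, 'm) cat" and B :: "('p, 'n) cat" +
  fixes Fo :: "'o \<Rightarrow> 'p" and Fa :: "'m \<Rightarrow> 'n"
  assumes Fo_Obj: "a \<in> Obj A \<Longrightarrow> Fo a \<in> Obj B"
    and Fa_Hom: "f \<in> Hom A a b \<Longrightarrow> Fa f \<in> Hom B (Fo a) (Fo b)"
    and Fa_Ident: "a \<in> Obj A \<Longrightarrow> Fa (Ident A a) = Ident B (Fo a)"
    and Fa_Comp: "f \<in> Hom A a b \<Longrightarrow> g \<in> Hom A b c \<Longrightarrow> Fa (g \<cdot>\<^bsub>A\<^esub> f) = Fa g \<cdot>\<^bsub>B\<^esub> Fa f"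

text \<open>The poset of natural numbers; the morphism \<open>i \<rightarrow> j\<close> is the pair \<open>(i, j)\<close>.\<close>

definition nat_cat :: "(nat, nat \<times> nat) cat" where
  "nat_cat = \<lparr>Obj = UNIV, Arr = {(i, j). i \<le> j}, Dom = fst, Cod = snd,
     Ident = (\<lambda>i. (i, i)), Comp = (\<lambda>g f. (fst f, snd g))\<rparr>"

text \<open>
  The slice category \<open>C/x\<close>. An object is its structure morphism \<open>a : Dom a \<rightarrow> x\<close>. A morphism
  \<open>a \<rightarrow> b\<close> is a triple \<open>(a, h, b)\<close> with \<open>h : Dom a \<rightarrow> Dom b\<close> and \<open>b \<cdot> h = a\<close>: the source \<open>a\<close> and the
  target \<open>b\<close> have to be recorded since \<open>h\<close> does not determine them.
\<close>

definition slice :: "('o, 'm) cat \<Rightarrow> 'o \<Rightarrow> ('m, 'm \<times> 'm \<times> 'm) cat" where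
  "slice C x = \<lparr>Obj = {a \<in> Arr C. Cod C a = x},
     Arr = {(a, h, b). a \<in> Arr C \<and> Cod C a = x \<and> b \<in> Arr C \<and> Cod C b = x
       \<and> h \<in> Hom C (Dom C a) (Dom C b) \<and> b \<cdot>\<^bsub>C\<^esub> h = a},
     Dom = fst, Cod = snd \<circ> snd,
     Ident = (\<lambda>a. (a, Ident C (Dom C a), a)),
     Comp = (\<lambda>(b', k, c) (a, h, b). (a, k \<cdot>\<^bsub>C\<^esub> h, c))\<rparr>"

definition slice_arr :: "'m \<times> 'm \<times> 'm \<Rightarrow> 'm" where
  "slice_arr t = fst (snd t)"

lemma category_nat_cat: "category nat_cat"
  by unfold_locales (auto simp: nat_cat_def Hom_def)

lemma Obj_slice: "Obj (slice C x) = {a \<in> Arr C. Cod C a = x}"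
  and Ident_slice: "Ident (slice C x) a = (a, Ident C (Dom C a), a)"
  and Comp_slice: "(b', k, c) \<cdot>\<^bsub>slice C x\<^esub> (a, h, b) = (a, k \<cdot>\<^bsub>C\<^esub> h, c)"
  by (simp_all add: slice_def)

lemma Hom_slice: "t \<in> Hom (slice C x) a b \<longleftrightarrow>
    (\<exists>h. t = (a, h, b) \<and> a \<in> Arr C \<and> Cod C a = x \<and> b \<in> Arr C \<and> Cod C b = x
       \<and> h \<in> Hom C (Dom C a) (Dom C b) \<and> b \<cdot>\<^bsub>C\<^esub> h = a)"
  unfolding Hom_def[of "slice C x"] by (cases t) (auto simp: slice_def)

lemma category_slice:
  assumes "category C"
  shows "category (slice C x)"
proof -
  interpret category C by fact
  have id: "Ident C (Dom C a) \<in> Hom C (Dom C a) (Dom C a)" "a \<cdot>\<^bsub>C\<^esub> Ident C (Dom C a) = a"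
    if "a \<in> Arr C" for a
    using that Ident_Hom[OF Dom_Obj] Comp_Ident[of a] by (auto simp: Hom_def)
  have comp: "c \<cdot>\<^bsub>C\<^esub> (k \<cdot>\<^bsub>C\<^esub> h) = (c \<cdot>\<^bsub>C\<^esub> k) \<cdot>\<^bsub>C\<^esub> h"
    if "c \<in> Arr C" "h \<in> Hom C u v" "k \<in> Hom C v (Dom C c)" for c h k u v
    using that Comp_assoc[of h u v k "Dom C c" c "Cod C c"] by (auto simp: Hom_def)
  show ?thesis
  proof unfold_locales
    show "Dom (slice C x) t \<in> Obj (slice C x)" "Cod (slice C x) t \<in> Obj (slice C x)"
      if "t \<in> Arr (slice C x)" for t
      using that by (auto simp: slice_def)
  qed (auto simp: Hom_slice Obj_slice Ident_slice Comp_slice id comp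
      intro: Comp_Hom Comp_Ident Ident_Comp Comp_assoc)
qed

definition is_iso :: "('o, 'm) cat \<Rightarrow> 'm \<Rightarrow> bool" where
  "is_iso C f \<longleftrightarrow> f \<in> Arr C \<and> (\<exists>g \<in> Hom C (Cod C f) (Dom C f).
     g \<cdot>\<^bsub>C\<^esub> f = Ident C (Dom C f) \<and> f \<cdot>\<^bsub>C\<^esub> g = Ident C (Cod C f))"

definition sections :: "('o, 'm) cat \<Rightarrow> 'm set" where
  "sections C = {s \<in> Arr C. \<exists>r \<in> Hom C (Cod C s) (Dom C s). r \<cdot>\<^bsub>C\<^esub> s = Ident C (Dom C s)}"

text \<open>
  \<open>is_pullback C f g p q\<close>: the square \<open>f \<cdot> p = g \<cdot> q\<close> is a pullback. Thus \<open>p\<close>, with codomain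
  \<open>Dom f\<close>, is the pullback of \<open>g\<close> along \<open>f\<close>.
\<close>

definition is_pullback :: "('o, 'm) cat \<Rightarrow> 'm \<Rightarrow> 'm \<Rightarrow> 'm \<Rightarrow> 'm \<Rightarrow> bool" where
  "is_pullback C f g p q \<longleftrightarrow>
     f \<in> Arr C \<and> g \<in> Arr C \<and> Cod C f = Cod C g
     \<and> p \<in> Arr C \<and> q \<in> Arr C \<and> Dom C p = Dom C q \<and> Cod C p = Dom C f \<and> Cod C q = Dom C g
     \<and> f \<cdot>\<^bsub>C\<^esub> p = g \<cdot>\<^bsub>C\<^esub> q
     \<and> (\<forall>w. \<forall>a \<in> Hom C w (Dom C f). \<forall>b \<in> Hom C w (Dom C g). f \<cdot>\<^bsub>C\<^esub> a = g \<cdot>\<^bsub>C\<^esub> b \<longrightarrow>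
          (\<exists>!h. h \<in> Hom C w (Dom C p) \<and> p \<cdot>\<^bsub>C\<^esub> h = a \<and> q \<cdot>\<^bsub>C\<^esub> h = b))"

definition has_pullbacks :: "('o, 'm) cat \<Rightarrow> bool" where
  "has_pullbacks C \<longleftrightarrow>
     (\<forall>f \<in> Arr C. \<forall>g \<in> Arr C. Cod C f = Cod C g \<longrightarrow> (\<exists>p q. is_pullback C f g p q))"

definition system :: "('o, 'm) cat \<Rightarrow> 'm set \<Rightarrow> bool" where
  "system C M \<longleftrightarrow> M \<subseteq> Arr C \<and> (\<forall>f. is_iso C f \<longrightarrow> f \<in> M)
     \<and> (\<forall>f \<in> M. \<forall>g \<in> M. Dom C g = Cod C f \<longrightarrow> g \<cdot>\<^bsub>C\<^esub> f \<in> M)"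

definition pullback_stable :: "('o, 'm) cat \<Rightarrow> 'm set \<Rightarrow> bool" where
  "pullback_stable C M \<longleftrightarrow> (\<forall>f g p q. is_pullback C f g p q \<longrightarrow> g \<in> M \<longrightarrow> p \<in> M)"

definition extremal_epi :: "('o, 'm) cat \<Rightarrow> 'm set \<Rightarrow> 'm \<Rightarrow> bool" where
  "extremal_epi C S g \<longleftrightarrow> g \<in> Arr C
     \<and> (\<forall>m \<in> S. \<forall>h \<in> Arr C. Cod C h = Dom C m \<longrightarrow> g = m \<cdot>\<^bsub>C\<^esub> h \<longrightarrow> is_iso C m)"

definition stably_extremal_epi :: "('o, 'm) cat \<Rightarrow> 'm set \<Rightarrow> 'm \<Rightarrow> bool" where
  "stably_extremal_epi C S g \<longleftrightarrow> g \<in> Arr C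
     \<and> (\<forall>f p q. is_pullback C f g p q \<longrightarrow> extremal_epi C S p)"

definition noetherian :: "('o, 'm) cat \<Rightarrow> 'm set \<Rightarrow> 'o \<Rightarrow> bool" where
  "noetherian C M x \<longleftrightarrow> x \<in> Obj C \<and>
     (\<forall>Fo Fa. cat_functor nat_cat (slice C x) Fo Fa \<longrightarrow> (\<forall>n. Fo n \<in> M) \<longrightarrow>
        (\<exists>i0. \<forall>i j. i0 \<le> i \<longrightarrow> i \<le> j \<longrightarrow> is_iso C (slice_arr (Fa (i, j)))))"

text \<open>Meaningful only for endomorphisms \<open>f\<close>, where \<open>Dom f = Cod f\<close>.\<close>

primrec endo_pow :: "('o, 'm) cat \<Rightarrow> 'm \<Rightarrow> nat \<Rightarrow> 'm" where
  "endo_pow C f 0 = Ident C (Dom C f)"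
| "endo_pow C f (Suc n) = f \<cdot>\<^bsub>C\<^esub> endo_pow C f n"

end

theory Submission
  imports Defs
begin

text \<open>
  Let \<open>\<pi>\<^sub>n : I\<^sub>n \<rightarrow> x\<close> and \<open>p\<^sub>n : I\<^sub>n \<rightarrow> I\<^sub>0\<close> be the pullback of \<open>\<pi>\<^sub>0\<close> and \<open>f\<^sup>n\<close>. Since \<open>f \<pi>\<^sub>0 = \<pi>\<^sub>0\<close>, the \<open>\<pi>\<^sub>n\<close>
  form a chain in \<open>C/x\<close>, so some transition \<open>I\<^sub>i \<rightarrow> I\<^sub>i\<^sub>+\<^sub>1\<close> is an isomorphism. Let \<open>s : I\<^sub>0 \<rightarrow> I\<^sub>1\<close> be the
  section of \<open>p\<^sub>1\<close> with \<open>\<pi>\<^sub>1 s = \<pi>\<^sub>0\<close>. The pullback \<open>u : I\<^sub>i\<^sub>+\<^sub>1 \<rightarrow> I\<^sub>1\<close> of \<open>f\<^sup>i\<close> along \<open>\<pi>\<^sub>1\<close> restricts along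
  \<open>I\<^sub>i \<rightarrow> I\<^sub>i\<^sub>+\<^sub>1\<close> to \<open>s p\<^sub>i\<close>, so \<open>u\<close> factors through \<open>s\<close>. As \<open>u\<close> is extremal, \<open>s\<close> is an isomorphism, and
  so is \<open>p\<^sub>1\<close>.
\<close>

lemma is_pullback_sym:
  assumes "is_pullback C f g p q"
  shows "is_pullback C g f q p"
proof -
  have "\<exists>!h. h \<in> Hom C w (Dom C q) \<and> q \<cdot>\<^bsub>C\<^esub> h = a \<and> p \<cdot>\<^bsub>C\<^esub> h = b"
    if "a \<in> Hom C w (Dom C g)" "b \<in> Hom C w (Dom C f)" "g \<cdot>\<^bsub>C\<^esub> a = f \<cdot>\<^bsub>C\<^esub> b" for w a b
  proof -
    have "\<exists>!h. h \<in> Hom C w (Dom C p) \<and> p \<cdot>\<^bsub>C\<^esub> h = b \<and> q \<cdot>\<^bsub>C\<^esub> h = a"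
      using assms that that(3)[symmetric] unfolding is_pullback_def by blast
    moreover have "Dom C p = Dom C q"
      using assms by (simp add: is_pullback_def)
    ultimately show ?thesis by (simp only: conj_commute)
  qed
  then show ?thesis
    using assms unfolding is_pullback_def by simp
qed

lemma is_pullback_Hom:
  assumes "is_pullback C f g p q"
  shows "p \<in> Hom C (Dom C p) (Dom C f)" "q \<in> Hom C (Dom C p) (Dom C g)"
    "f \<in> Hom C (Dom C f) (Cod C f)" "g \<in> Hom C (Dom C g) (Cod C f)"
  using assms by (auto simp: is_pullback_def Hom_def)

lemma is_pullback_commute: "is_pullback C f g p q \<Longrightarrow> f \<cdot>\<^bsub>C\<^esub> p = g \<cdot>\<^bsub>C\<^esub> q"
  by (simp add: is_pullback_def)

lemma is_pullback_lift:
  assumes "is_pullback C f g p q" "a \<in> Hom C w (Dom C f)" "b \<in> Hom C w (Dom C g)"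
    "f \<cdot>\<^bsub>C\<^esub> a = g \<cdot>\<^bsub>C\<^esub> b"
  obtains h where "h \<in> Hom C w (Dom C p)" "p \<cdot>\<^bsub>C\<^esub> h = a" "q \<cdot>\<^bsub>C\<^esub> h = b"
proof -
  have "\<exists>!h. h \<in> Hom C w (Dom C p) \<and> p \<cdot>\<^bsub>C\<^esub> h = a \<and> q \<cdot>\<^bsub>C\<^esub> h = b"
    using assms unfolding is_pullback_def by blast
  then show thesis using that by blast
qed

context category
begin

lemma is_pullback_cancel:
  assumes pb: "is_pullback C f g p q"
    and h: "h \<in> Hom C w (Dom C p)" and h': "h' \<in> Hom C w (Dom C p)"
    and eq: "p \<cdot> h = p \<cdot> h'" "q \<cdot> h = q \<cdot> h'"
  shows "h = h'"
proof -
  note H = is_pullback_Hom[OF pb]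
  have "f \<cdot> (p \<cdot> h) = g \<cdot> (q \<cdot> h)"
    using Comp_assoc[OF h H(1,3)] Comp_assoc[OF h H(2,4)] is_pullback_commute[OF pb] by simp
  moreover have "p \<cdot> h \<in> Hom C w (Dom C f)" "q \<cdot> h \<in> Hom C w (Dom C g)"
    using Comp_Hom[OF h] H by auto
  ultimately have "\<exists>!k. k \<in> Hom C w (Dom C p) \<and> p \<cdot> k = p \<cdot> h \<and> q \<cdot> k = q \<cdot> h"
    using pb unfolding is_pullback_def by blast
  then show ?thesis using h h' eq by metis
qed

text \<open>Pasting: when the square of \<open>g\<close> and \<open>f\<close> and the outer
  rectangle are pullbacks, so is the remaining square. A cone \<open>b\<close>, \<open>c\<close> on
  it is first lifted through the rectangle as the cone \<open>p \<cdot> b\<close>, \<open>c\<close>;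
  joint monicity of \<open>p\<close> and \<open>q\<close> then recovers \<open>b\<close>.\<close>

lemma is_pullback_left_square:
  assumes pb: "is_pullback C g f p q" and outer: "is_pullback C g (f \<cdot> k) p' q'"
    and k: "k \<in> Hom C a (Dom C f)"
    and u: "u \<in> Hom C (Dom C p') (Dom C p)" and pu: "p \<cdot> u = p'" and qu: "q \<cdot> u = k \<cdot> q'"
  shows "is_pullback C q k u q'"
proof -
  note P = is_pullback_Hom[OF pb] and O = is_pullback_Hom[OF outer]
  have dom_fk: "Dom C (f \<cdot> k) = a"
    using Comp_Hom[OF k P(4)] by (simp add: Hom_def)
  have dom_u: "Dom C u = Dom C p'" and dom_q: "Dom C q = Dom C p" and dom_k: "Dom C k = a"
    using u P k by (auto simp: Hom_def)
  have q': "q' \<in> Hom C (Dom C p') a"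
    using O(2) dom_fk by simp
  have "\<exists>!h. h \<in> Hom C w (Dom C u) \<and> u \<cdot> h = b \<and> q' \<cdot> h = c"
    if b: "b \<in> Hom C w (Dom C q)" and c: "c \<in> Hom C w (Dom C k)" and eq: "q \<cdot> b = k \<cdot> c" for w b c
  proof -
    note b = b[unfolded dom_q] and c = c[unfolded dom_k]
    have "g \<cdot> (p \<cdot> b) = (f \<cdot> k) \<cdot> c"
      using Comp_assoc[OF b P(1) P(3)] Comp_assoc[OF b P(2) P(4)] is_pullback_commute[OF pb]
        Comp_assoc[OF c k P(4)] eq by simp
    then obtain h where h: "h \<in> Hom C w (Dom C p')" "p' \<cdot> h = p \<cdot> b" "q' \<cdot> h = c"
      using is_pullback_lift[OF outer Comp_Hom[OF b P(1)], of c] c dom_fk by auto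
    have "u \<cdot> h = b"
    proof (rule is_pullback_cancel[OF pb Comp_Hom[OF h(1) u] b])
      show "p \<cdot> (u \<cdot> h) = p \<cdot> b"
        using Comp_assoc[OF h(1) u P(1)] pu h by simp
      show "q \<cdot> (u \<cdot> h) = q \<cdot> b"
        using Comp_assoc[OF h(1) u P(2)] Comp_assoc[OF h(1) q' k] qu h eq by simp
    qed
    moreover have "h' = h" if h': "h' \<in> Hom C w (Dom C p')" "u \<cdot> h' = b" "q' \<cdot> h' = c" for h'
      using is_pullback_cancel[OF outer h'(1) h(1)] Comp_assoc[OF h'(1) u P(1)] pu h h' by simp
    ultimately show ?thesis
      unfolding dom_u using h(1,3) by blast
  qed
  moreover have "q \<in> Arr C" "k \<in> Arr C" "Cod C q = Cod C k" "u \<in> Arr C" "q' \<in> Arr C"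
    "Dom C u = Dom C q'" "Cod C u = Dom C q" "Cod C q' = Dom C k"
    using P(2) q' u k by (simp_all add: Hom_def)
  ultimately show ?thesis
    using qu unfolding is_pullback_def by blast
qed

lemma endo_pow_Hom:
  assumes f: "f \<in> Hom C x x"
  shows "endo_pow C f n \<in> Hom C x x"
proof (induction n)
  case 0
  show ?case
    using f Ident_Hom[OF Dom_Obj[of f]] by (simp add: Hom_def)
next
  case (Suc n)
  then show ?case using Comp_Hom f by simp
qed

text \<open>Each further \<open>f\<close> is absorbed by \<open>g\<close> because
  \<open>f \<cdot> g = g\<close>. Hence a cone over \<open>f^i\<close> and \<open>g\<close> is also
  a cone over every later power, which yields the transition maps of the chain.\<close>

lemma endo_pow_fixed:
  assumes f: "f \<in> Hom C x x" and g: "g \<in> Hom C a x" and fg: "f \<cdot> g = g"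
    and t: "t \<in> Hom C b x" and r: "r \<in> Hom C b a"
    and eq: "endo_pow C f i \<cdot> t = g \<cdot> r" and "i \<le> j"
  shows "endo_pow C f j \<cdot> t = g \<cdot> r"
  using \<open>i \<le> j\<close>
proof (induction rule: dec_induct)
  case base
  show ?case by (rule eq)
next
  case (step j)
  then show ?case
    using Comp_assoc[OF t endo_pow_Hom[OF f] f] Comp_assoc[OF r g f] fg by simp
qed

text \<open>Cancelling a right inverse \<open>k\<close> of \<open>s\<close> in
  \<open>r \<cdot> s \<cdot> k\<close> gives \<open>r = k\<close>.\<close>

lemma isoI_retraction:
  assumes s: "is_iso C s" and r: "r \<in> Hom C (Cod C s) (Dom C s)" and rs: "r \<cdot> s = Ident C (Dom C s)"
  shows "is_iso C r"
proof -
  obtain k where k: "k \<in> Hom C (Cod C s) (Dom C s)" "s \<cdot> k = Ident C (Cod C s)"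
    using s by (auto simp: is_iso_def)
  have s': "s \<in> Hom C (Dom C s) (Cod C s)"
    using s by (auto simp: is_iso_def Hom_def)
  have "r = k"
    using Comp_assoc[OF k(1) s' r] k rs Comp_Ident[OF r] Ident_Comp[OF k(1)] by simp
  then show ?thesis
    using k rs s' r unfolding is_iso_def by (auto simp: Hom_def)
qed

text \<open>Interface to \<open>noetherian\<close>: the chain is given by maps of \<open>C\<close>
  itself, and \<open>h_id\<close> and \<open>h_comp\<close> supply the functor laws in the
  slice.\<close>

lemma noetherian_chain:
  fixes t :: "nat \<Rightarrow> 'm"
  assumes noeth: "noetherian C M x" and M: "\<And>n. t n \<in> M"
    and t: "\<And>n. t n \<in> Hom C (d n) x"
    and h: "\<And>i j. i \<le> j \<Longrightarrow> h i j \<in> Hom C (d i) (d j)"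
    and th: "\<And>i j. i \<le> j \<Longrightarrow> t j \<cdot> h i j = t i"
    and h_id: "\<And>i. h i i = Ident C (d i)"
    and h_comp: "\<And>i j k. i \<le> j \<Longrightarrow> j \<le> k \<Longrightarrow> h j k \<cdot> h i j = h i k"
  obtains i where "\<And>j k. i \<le> j \<Longrightarrow> j \<le> k \<Longrightarrow> is_iso C (h j k)"
proof -
  define Fa where "Fa = (\<lambda>(i, j). (t i, h i j, t j))"
  have d: "t n \<in> Arr C" "Dom C (t n) = d n" "Cod C (t n) = x" for n
    using t[of n] by (auto simp: Hom_def)
  have nat_cat: "u \<in> Hom nat_cat i j \<longleftrightarrow> u = (i, j) \<and> i \<le> j" "Ident nat_cat i = (i, i)"
    "v \<cdot>\<^bsub>nat_cat\<^esub> u = (fst u, snd v)" for u v i j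
    by (auto simp: Hom_def nat_cat_def)
  have "cat_functor nat_cat (slice C x) t Fa"
    by (intro cat_functor.intro cat_functor_axioms.intro category_nat_cat category_slice
        category_axioms)
      (auto simp: Fa_def Hom_slice Obj_slice Ident_slice Comp_slice d h th h_id h_comp
        nat_cat)
  then obtain i where "\<And>j k. i \<le> j \<Longrightarrow> j \<le> k \<Longrightarrow> is_iso C (slice_arr (Fa (j, k)))"
    using noeth M unfolding noetherian_def by blast
  then show thesis
    using that by (auto simp: slice_arr_def Fa_def)
qed

end

theorem theorem2p10:
  fixes C :: "('o, 'm) cat" and M :: "'m set" and x I0 :: 'o and f \<pi>0 p q :: 'm
  assumes "category C" and "has_pullbacks C"
    and "system C M" and "pullback_stable C M"
    and "f \<in> Hom C x x"
    and "noetherian C M x"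
    and "\<And>n. stably_extremal_epi C (sections C) (endo_pow C f n)"
    and "\<pi>0 \<in> Hom C I0 x" and "\<pi>0 \<in> M" and "f \<cdot>\<^bsub>C\<^esub> \<pi>0 = \<pi>0"
    and "is_pullback C \<pi>0 f p q"
  shows "is_iso C p"
proof -
  interpret category C by fact
  note f = assms(5) and \<pi>0 = assms(8) and fix_\<pi>0 = assms(10) and pb = assms(11)
  note fn = endo_pow_Hom[OF f]
  have dom: "Dom C \<pi>0 = I0" "Dom C f = x" "Dom C (endo_pow C f n) = x" for n
    using f \<pi>0 fn[of n] by (auto simp: Hom_def)
  have "\<exists>r t. is_pullback C \<pi>0 (endo_pow C f n) r t" for n
    using assms(2) \<pi>0 fn[of n] unfolding has_pullbacks_def Hom_def by auto
  then obtain r t where rt: "\<And>n. is_pullback C \<pi>0 (endo_pow C f n) (r n) (t n)"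
    by metis
  define d where "d n = Dom C (r n)" for n
  have r: "r n \<in> Hom C (d n) I0" and t: "t n \<in> Hom C (d n) x" for n
    using is_pullback_Hom[OF rt[of n]] by (auto simp: dom d_def)
  have sq: "endo_pow C f n \<cdot>\<^bsub>C\<^esub> t n = \<pi>0 \<cdot>\<^bsub>C\<^esub> r n" for n
    using is_pullback_commute[OF rt[of n]] by simp
  \<comment> \<open>Up to swapping the two legs, \<open>t n\<close> is the pullback of
    \<open>\<pi>0\<close> along \<open>f^n\<close>, so stability of \<open>M\<close>
    applies.\<close>
  have tM: "t n \<in> M" for n
    using assms(4,9) is_pullback_sym[OF rt[of n]] unfolding pullback_stable_def by blast
  have "\<exists>h. h \<in> Hom C (d i) (d j) \<and> r j \<cdot>\<^bsub>C\<^esub> h = r i \<and> t j \<cdot>\<^bsub>C\<^esub> h = t i" if "i \<le> j" for i j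
    using is_pullback_lift[OF rt[of j], of "r i" "d i" "t i"]
      endo_pow_fixed[OF f \<pi>0 fix_\<pi>0 t r sq that] r t by (metis dom(1,3) d_def)
  then obtain h where h: "\<And>i j. i \<le> j \<Longrightarrow> h i j \<in> Hom C (d i) (d j)"
    and rh: "\<And>i j. i \<le> j \<Longrightarrow> r j \<cdot>\<^bsub>C\<^esub> h i j = r i" and th: "\<And>i j. i \<le> j \<Longrightarrow> t j \<cdot>\<^bsub>C\<^esub> h i j = t i"
    by metis
  have d_Obj: "d n \<in> Obj C" for n
    using t[of n] Dom_Obj[of "t n"] by (auto simp: Hom_def)
  \<comment> \<open>The maps \<open>h i j\<close> were merely chosen; functoriality follows because
    \<open>r\<close> and \<open>t\<close> are jointly monic and every \<open>h i j\<close> commutes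
    with both.\<close>
  have h_id: "h i i = Ident C (d i)" for i
    using is_pullback_cancel[OF rt[of i], folded d_def, OF h Ident_Hom[OF d_Obj]]
    by (simp add: rh th Comp_Ident[OF r] Comp_Ident[OF t])
  have h_comp: "h j k \<cdot>\<^bsub>C\<^esub> h i j = h i k" if "i \<le> j" "j \<le> k" for i j k
    using is_pullback_cancel[OF rt[of k], folded d_def,
        OF Comp_Hom[OF h[OF that(1)] h[OF that(2)]] h[OF order_trans[OF that]]]
      Comp_assoc[OF h[OF that(1)] h[OF that(2)] r] Comp_assoc[OF h[OF that(1)] h[OF that(2)] t]
      that by (simp add: rh th)
  obtain i where "\<And>j k. i \<le> j \<Longrightarrow> j \<le> k \<Longrightarrow> is_iso C (h j k)"
    by (rule noetherian_chain[OF assms(6), of t d h])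
      (use tM t h th h_id h_comp in blast)+
  then have "is_iso C (h i (Suc i))" by simp
  then obtain g where g: "g \<in> Hom C (d (Suc i)) (d i)"
    and hg: "h i (Suc i) \<cdot>\<^bsub>C\<^esub> g = Ident C (d (Suc i))"
    using h[of i "Suc i"] by (auto simp: is_iso_def Hom_def)
  note h = h[of i "Suc i", simplified] and rh = rh[of i "Suc i", simplified]
    and th = th[of i "Suc i", simplified]

  note P = is_pullback_Hom[OF pb, unfolded dom]
  have I0: "Ident C I0 \<in> Hom C I0 I0"
    using \<pi>0 Dom_Obj Ident_Hom by (auto simp: Hom_def)
  \<comment> \<open>The fixed point equation says exactly that the identity of \<open>I0\<close> and
    \<open>\<pi>0\<close> form a cone over \<open>\<pi>0\<close> and \<open>f\<close>.\<close>
  obtain s where s: "s \<in> Hom C I0 (Dom C p)" "p \<cdot>\<^bsub>C\<^esub> s = Ident C I0" "q \<cdot>\<^bsub>C\<^esub> s = \<pi>0"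
    using is_pullback_lift[OF pb, unfolded dom, OF I0 \<pi>0] Comp_Ident[OF \<pi>0] fix_\<pi>0 by auto
  have s_section: "s \<in> sections C"
    using s P by (auto simp: sections_def Hom_def)

  have "\<pi>0 \<cdot>\<^bsub>C\<^esub> r (Suc i) = f \<cdot>\<^bsub>C\<^esub> (endo_pow C f i \<cdot>\<^bsub>C\<^esub> t (Suc i))"
    using sq[of "Suc i"] Comp_assoc[OF t fn f] by simp
  then obtain u where u: "u \<in> Hom C (d (Suc i)) (Dom C p)" "p \<cdot>\<^bsub>C\<^esub> u = r (Suc i)"
    "q \<cdot>\<^bsub>C\<^esub> u = endo_pow C f i \<cdot>\<^bsub>C\<^esub> t (Suc i)"
    using is_pullback_lift[OF pb, unfolded dom, OF r Comp_Hom[OF t fn]] by metis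
  \<comment> \<open>The pullback of \<open>\<pi>0\<close> and \<open>f^(i+1)\<close> is the outer
    rectangle for the factorization of \<open>f^(i+1)\<close> as \<open>f\<close> after
    \<open>f^i\<close>. By pasting, \<open>u\<close> is a pullback of \<open>f^i\<close>, so the
    extremality hypothesis reaches it.\<close>
  have "is_pullback C q (endo_pow C f i) u (t (Suc i))"
    using is_pullback_left_square[OF pb rt[of "Suc i", simplified], of x u] fn u
    by (simp add: dom d_def)
  then have u_ext: "extremal_epi C (sections C) u"
    using assms(7) unfolding stably_extremal_epi_def by blast
  \<comment> \<open>Both sides become \<open>r i\<close> under \<open>p\<close> and
    \<open>\<pi>0 \<cdot> r i\<close> under \<open>q\<close>; for the left side the latter is the
    square \<open>sq\<close> at \<open>i\<close>.\<close>
  have "u \<cdot>\<^bsub>C\<^esub> h i (Suc i) = s \<cdot>\<^bsub>C\<^esub> r i"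
  proof (rule is_pullback_cancel[OF pb Comp_Hom[OF h u(1)] Comp_Hom[OF r s(1)]])
    show "p \<cdot>\<^bsub>C\<^esub> (u \<cdot>\<^bsub>C\<^esub> h i (Suc i)) = p \<cdot>\<^bsub>C\<^esub> (s \<cdot>\<^bsub>C\<^esub> r i)"
      using Comp_assoc[OF h u(1) P(1)] Comp_assoc[OF r[of i] s(1) P(1)] u(2) rh s(2)
        Ident_Comp[OF r[of i]] by simp
    show "q \<cdot>\<^bsub>C\<^esub> (u \<cdot>\<^bsub>C\<^esub> h i (Suc i)) = q \<cdot>\<^bsub>C\<^esub> (s \<cdot>\<^bsub>C\<^esub> r i)"
      using Comp_assoc[OF h u(1) P(2)] Comp_assoc[OF r[of i] s(1) P(2)] u(3) th s(3)
        Comp_assoc[OF h t fn[of i]] sq[of i] by simp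
  qed
  \<comment> \<open>Composing with the right inverse \<open>g\<close> of the transition map removes
    it from the left side.\<close>
  then have "u = s \<cdot>\<^bsub>C\<^esub> (r i \<cdot>\<^bsub>C\<^esub> g)"
    using Comp_assoc[OF g h u(1)] Comp_assoc[OF g r s(1)] hg Comp_Ident[OF u(1)] by simp
  then have "is_iso C s"
    using u_ext s_section Comp_Hom[OF g r] s(1) unfolding extremal_epi_def by (auto simp: Hom_def)
  then show ?thesis
    using isoI_retraction[of s p] s P by (auto simp: Hom_def)
qed

end
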